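(* For any integers $k\ge 1$ and $l\ge 2$, as $n\to\infty$, $$ex(n,C_{2l},C_{2k+1})=(1+o(1))\frac{1}{2l}\left(\frac{n^2}{4}\right)^l.$$
   Context: $C_k$ denotes the cycle with $k$ vertices. $ex(n,H,F)$ is the maximum number of subgraphs isomorphic to $H$ in an $n$-vertex graph containing no subgraph isomorphic to $F$. *)

theory Defs
  imports Complex_Main "HOL-Library.Landau_Symbols"
begin

text \<open>Simple graphs on the vertex set {0..<n}: a set of 2-element edges.
  Every n-vertex simple graph is isomorphic to one of these.\<close>
definition simple_graph :: "nat \<Rightarrow> nat set set \<Rightarrow> bool" where
  "simple_graph n E \<longleftrightarrow> (\<forall>e\<in>E. \<exists>u v. e = {u, v} \<and> u \<noteq> v \<and> u < n \<and> v < n)"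

definition cycle_edges :: "nat \<Rightarrow> (nat \<Rightarrow> nat) \<Rightarrow> nat set set" where
  "cycle_edges m f = {{f i, f ((i + 1) mod m)} | i. i < m}"

text \<open>Subgraphs of E isomorphic to the cycle C_m (for m \<ge> 3), identified by their edge sets.\<close>
definition cycle_subgraphs :: "nat \<Rightarrow> nat set set \<Rightarrow> nat set set set" where
  "cycle_subgraphs m E = {C. \<exists>f. inj_on f {..<m} \<and> C = cycle_edges m f \<and> C \<subseteq> E}"

definition num_cycles :: "nat \<Rightarrow> nat set set \<Rightarrow> nat" where
  "num_cycles m E = card (cycle_subgraphs m E)"

definition has_cycle :: "nat \<Rightarrow> nat set set \<Rightarrow> bool" where
  "has_cycle m E \<longleftrightarrow> cycle_subgraphs m E \<noteq> {}"

definition ex_cycle :: "nat \<Rightarrow> nat \<Rightarrow> nat \<Rightarrow> nat" where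
  "ex_cycle n h f = Max {num_cycles h E | E. simple_graph n E \<and> \<not> has_cycle f E}"

end

theory Submission
  imports Defs "HOL-Library.FuncSet" "HOL-Analysis.Convex"
begin

text \<open>
  Lower bound: the balanced complete bipartite graph. Upper bound: a \<open>C\<^bsub>2k+1\<^esub>\<close>-free graph has
  no path on \<open>2k\<close> vertices inside a neighbourhood, so neighbourhoods span \<open>O(n)\<close> edges and there are
  only \<open>O(n\<^sup>2)\<close> triangles; double counting then gives at most \<open>n\<^sup>2/4 + O(n)\<close> edges. Send a labelled
  \<open>C\<^bsub>2l\<^esub>\<close> to the sequence of its \<open>l\<close> alternate edges. If no three consecutive vertices of the cycle
  span a triangle, orienting one of these edges forces the orientation of the next, so each of the
  \<open>e(G)\<^sup>l\<close> sequences comes from at most two such cycles; the remaining labelled cycles contain a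
  triangle and number only \<open>O(n\<^bsup>2l-1\<^esup>)\<close>. Each \<open>C\<^bsub>2l\<^esub>\<close> has \<open>4l\<close> labellings.
\<close>

subsection \<open>Labelled cycles\<close>

text \<open>Ordered pairs, so each edge counts twice: sizes become degree sums, and the first two
  vertices of a labelled cycle form an arc.\<close>

definition arcs :: "nat set set \<Rightarrow> (nat \<times> nat) set" where
  "arcs E = {(a, b). {a, b} \<in> E}"

text \<open>Extensionality fixes the values outside the positions below \<open>m\<close>, so each
  labelled cycle is exactly one function and can be counted.\<close>

definition cycle_embeddings :: "nat \<Rightarrow> nat set set \<Rightarrow> (nat \<Rightarrow> nat) set" where
  "cycle_embeddings m E =
    {f \<in> extensional {..<m}. inj_on f {..<m} \<and> cycle_edges m f \<subseteq> E}"

lemma simple_graph_subset: "simple_graph n E \<Longrightarrow> F \<subseteq> E \<Longrightarrow> simple_graph n F"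
  by (auto simp: simple_graph_def)

lemma simple_graph_edgeD:
  assumes "simple_graph n E" "{u, v} \<in> E"
  shows "u < n" "v < n" "u \<noteq> v"
  using assms by (fastforce simp: simple_graph_def doubleton_eq_iff)+

lemma simple_graph_finite:
  assumes "simple_graph n E"
  shows "finite E"
proof -
  have "E \<subseteq> Pow {..<n}"
    using assms by (fastforce simp: simple_graph_def)
  then show ?thesis
    by (rule finite_subset) simp
qed

lemma simple_graph_card_edge: "simple_graph n E \<Longrightarrow> e \<in> E \<Longrightarrow> card e = 2"
  by (auto simp: simple_graph_def)

lemma arcs_subset:
  assumes "simple_graph n E"
  shows "arcs E \<subseteq> {..<n} \<times> {..<n}"
  using simple_graph_edgeD[OF assms] by (auto simp: arcs_def)

lemma finite_arcs: "simple_graph n E \<Longrightarrow> finite (arcs E)"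
  by (rule finite_subset[OF arcs_subset]) auto

lemma card_arcs:
  assumes "simple_graph n E"
  shows "card (arcs E) = 2 * card E"
proof -
  let ?F = "\<lambda>e. {(a, b). {a, b} = e}"
  have F: "card (?F e) = 2 \<and> finite (?F e)" if "e \<in> E" for e :: "nat set"
  proof -
    obtain u v where e: "e = {u, v}" "u \<noteq> v"
      using assms \<open>e \<in> E\<close> by (auto simp: simple_graph_def)
    have "?F e = {(u, v), (v, u)}"
      using e by (auto simp: doubleton_eq_iff)
    then show ?thesis
      using e by simp
  qed
  have "arcs E = (\<Union>e\<in>E. ?F e)"
    by (auto simp: arcs_def)
  also have "card \<dots> = (\<Sum>e\<in>E. card (?F e))"
    by (rule card_UN_disjoint) (use F simple_graph_finite[OF assms] in auto)
  also have "\<dots> = 2 * card E"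
    using F by simp
  finally show ?thesis .
qed

section \<open>Symmetries and labellings of a cycle\<close>

lemma cycle_edges_eq_image: "cycle_edges m f = (\<lambda>i. {f i, f ((i + 1) mod m)}) ` {..<m}"
  by (auto simp: cycle_edges_def)

lemma cycle_edges_subset_iff:
  "cycle_edges m f \<subseteq> E \<longleftrightarrow> (\<forall>i<m. {f i, f ((i + 1) mod m)} \<in> E)"
  by (auto simp: cycle_edges_def)

lemma cycle_edges_cong:
  assumes "\<And>i. i < m \<Longrightarrow> f i = g i"
  shows "cycle_edges m f = cycle_edges m g"
  unfolding cycle_edges_eq_image
  by (rule image_cong) (use assms in \<open>auto intro!: arg_cong2[of _ _ _ _ insert]\<close>)

text \<open>If the two pairs agreed crosswise, \<open>i\<close> and \<open>j\<close> would each be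
  the cyclic successor of the other, which forces \<open>m\<close> to divide 2; this is where
  \<open>m \<ge> 3\<close> enters.\<close>

lemma cycle_edges_pair_inj:
  fixes m :: nat
  assumes "m \<ge> 3" "inj_on f {..<m}" "i < m" "j < m"
    and "{f i, f ((i + 1) mod m)} = {f j, f ((j + 1) mod m)}"
  shows "i = j"
proof -
  have "f i = f j \<or> (f i = f ((j + 1) mod m) \<and> f ((i + 1) mod m) = f j)"
    using assms(5) by (auto simp: doubleton_eq_iff)
  then have "i = j \<or> (i = (j + 1) mod m \<and> (i + 1) mod m = j)"
    using assms(1,3,4) by (auto dest!: inj_onD[OF assms(2)])
  then show ?thesis
    using assms(1,3,4) by (auto simp: mod_Suc split: if_splits)
qed

lemma card_cycle_edges:
  assumes "m \<ge> 3" "inj_on f {..<m}"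
  shows "card (cycle_edges m f) = m"
proof -
  have "inj_on (\<lambda>i. {f i, f ((i + 1) mod m)}) {..<m}"
    using cycle_edges_pair_inj[OF assms] by (intro inj_onI) auto
  then show ?thesis
    by (simp add: cycle_edges_eq_image card_image)
qed

text \<open>An inclusion suffices for membership in \<open>cycle_embeddings\<close>; equality then
  follows by counting edges in \<open>cycle_embedding_edges_eq\<close>.\<close>

lemma cycle_edges_rotate:
  assumes "i < m"
  shows "cycle_edges m (\<lambda>j. f ((i + j) mod m)) \<subseteq> cycle_edges m f"
    and "inj_on f {..<m} \<Longrightarrow> inj_on (\<lambda>j. f ((i + j) mod m)) {..<m}"
proof -
  show "cycle_edges m (\<lambda>j. f ((i + j) mod m)) \<subseteq> cycle_edges m f"
    unfolding cycle_edges_subset_iff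
  proof (intro allI impI)
    fix j assume "j < m"
    have "(i + (j + 1) mod m) mod m = ((i + j) mod m + 1) mod m"
      by (simp add: mod_simps)
    then show "{f ((i + j) mod m), f ((i + (j + 1) mod m) mod m)} \<in> cycle_edges m f"
      using assms by (auto simp: cycle_edges_def intro!: exI[of _ "(i + j) mod m"])
  qed
  have *: "(i + j) mod m = (if i + j < m then i + j else i + j - m)" if "j < m" for j
    using assms that by (auto simp: mod_if)
  have "inj_on (\<lambda>j. (i + j) mod m) {..<m}"
    by (rule inj_onI) (use assms in \<open>auto simp: * split: if_splits\<close>)
  moreover have "(\<lambda>j. (i + j) mod m) ` {..<m} \<subseteq> {..<m}"
    using assms by auto
  ultimately show "inj_on f {..<m} \<Longrightarrow> inj_on (\<lambda>j. f ((i + j) mod m)) {..<m}"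
    using comp_inj_on[of "\<lambda>j. (i + j) mod m" "{..<m}" f, unfolded o_def] by (blast intro: inj_on_subset)
qed

lemma cycle_edges_reverse:
  shows "cycle_edges m (\<lambda>j. f (m - 1 - j)) \<subseteq> cycle_edges m f"
    and "inj_on f {..<m} \<Longrightarrow> inj_on (\<lambda>j. f (m - 1 - j)) {..<m}"
proof -
  show "cycle_edges m (\<lambda>j. f (m - 1 - j)) \<subseteq> cycle_edges m f"
    unfolding cycle_edges_subset_iff
  proof (intro allI impI)
    fix j assume "j < m"
    define i where "i = m - 1 - (j + 1) mod m"
    have "i < m" "m - 1 - j = (i + 1) mod m"
      using \<open>j < m\<close> by (auto simp: i_def mod_Suc)
    then have "{f (m - 1 - j), f (m - 1 - (j + 1) mod m)} = {f i, f ((i + 1) mod m)}"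
      unfolding i_def[symmetric] by auto
    then show "{f (m - 1 - j), f (m - 1 - (j + 1) mod m)} \<in> cycle_edges m f"
      using \<open>i < m\<close> by (auto simp: cycle_edges_def)
  qed
  show "inj_on (\<lambda>j. f (m - 1 - j)) {..<m}" if "inj_on f {..<m}"
  proof (rule inj_onI)
    fix x y assume xy: "x \<in> {..<m}" "y \<in> {..<m}" "f (m - 1 - x) = f (m - 1 - y)"
    have "m - 1 - x = m - 1 - y"
      by (rule inj_onD[OF that xy(3)]) (use xy in auto)
    then show "x = y"
      using xy by auto
  qed
qed

text \<open>On a cycle every vertex has just two neighbours, and one of them is the vertex just
  left. So the first two labels force the whole walk.\<close>

lemma cycle_embedding_eqI:
  assumes "m \<ge> 3" and f: "f \<in> cycle_embeddings m C" and g: "g \<in> cycle_embeddings m C"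
    and C: "C = cycle_edges m g" and eq: "f 0 = g 0" "f 1 = g 1"
  shows "f = g"
proof -
  have injf: "inj_on f {..<m}" and injg: "inj_on g {..<m}"
    and fC: "\<And>i. i < m \<Longrightarrow> {f i, f ((i + 1) mod m)} \<in> cycle_edges m g"
    using f g C by (auto simp: cycle_embeddings_def cycle_edges_subset_iff)
  have step: "i + 1 < m \<longrightarrow> f i = g i \<and> f (i + 1) = g (i + 1)" for i
  proof (induction i)
    case 0
    then show ?case using eq by simp
  next
    case (Suc i)
    show ?case
    proof
      assume im: "Suc i + 1 < m"
      have IH: "f i = g i" "f (i + 1) = g (i + 1)"
        using Suc im by auto
      obtain j where j: "j < m" "{f (i + 1), f (i + 2)} = {g j, g ((j + 1) mod m)}"
        using fC[of "i + 1"] im by (auto simp: cycle_edges_def)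
      then consider "g (i + 1) = g j" "f (i + 2) = g ((j + 1) mod m)"
        | "g (i + 1) = g ((j + 1) mod m)" "f (i + 2) = g j"
        using IH by (auto simp: doubleton_eq_iff)
      then have "f (i + 2) = g (i + 2)"
      proof cases
        case 1
        then have "i + 1 = j"
          using inj_onD[OF injg 1(1)] im j by auto
        then show ?thesis using 1 im by auto
      next
        case 2
        then have "i + 1 = (j + 1) mod m"
          using inj_onD[OF injg 2(1)] im j by auto
        \<comment> \<open>In this case the walk would turn back to the vertex at position
          \<open>i\<close>, against injectivity of \<open>f\<close>.\<close>
        then have "j = i"
          using im j by (auto simp: mod_Suc split: if_splits)
        then have "f (i + 2) = f i"
          using 2 IH by simp
        then show ?thesis
          using inj_onD[OF injf, of "i + 2" i] im by auto
      qed
      then show "f (Suc i) = g (Suc i) \<and> f (Suc i + 1) = g (Suc i + 1)"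
        using IH by simp
    qed
  qed
  have "f i = g i" if "i < m" for i
    using step[of i] step[of "i - 1"] that assms(1) by (cases "i = 0") auto
  moreover have "f \<in> extensional {..<m}" "g \<in> extensional {..<m}"
    using f g by (auto simp: cycle_embeddings_def)
  ultimately show ?thesis
    by (intro extensionalityI[of _ "{..<m}"]) auto
qed

lemma cycle_embedding_edges_eq:
  assumes "m \<ge> 3" "inj_on f {..<m}" "inj_on g {..<m}" "cycle_edges m g \<subseteq> cycle_edges m f"
  shows "cycle_edges m g = cycle_edges m f"
  by (rule card_subset_eq) (use assms card_cycle_edges in \<open>auto simp: cycle_edges_eq_image\<close>)

text \<open>A rotation moves the given edge to positions 0 and 1; if it is traversed in the wrong
  direction, the labelling is reversed first.\<close>

lemma cycle_embedding_through_arc: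
  assumes m: "m \<ge> 3" and inj: "inj_on f {..<m}" and uv: "{u, v} \<in> cycle_edges m f"
  shows "\<exists>g \<in> cycle_embeddings m (cycle_edges m f). g 0 = u \<and> g 1 = v"
proof -
  have rot: "\<exists>g \<in> cycle_embeddings m (cycle_edges m f). g 0 = h i \<and> g 1 = h ((i + 1) mod m)"
    if "inj_on h {..<m}" "cycle_edges m h \<subseteq> cycle_edges m f" "i < m" for h i
  proof
    let ?g = "restrict (\<lambda>j. h ((i + j) mod m)) {..<m}"
    have "cycle_edges m ?g = cycle_edges m (\<lambda>j. h ((i + j) mod m))"
      by (rule cycle_edges_cong) simp
    then show "?g \<in> cycle_embeddings m (cycle_edges m f)"
      using cycle_edges_rotate[OF that(3), of h] that by (auto simp: cycle_embeddings_def)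
    show "?g 0 = h i \<and> ?g 1 = h ((i + 1) mod m)"
      using m that by simp
  qed
  obtain i where i: "i < m" "{u, v} = {f i, f ((i + 1) mod m)}"
    using uv by (auto simp: cycle_edges_def)
  then consider "u = f i" "v = f ((i + 1) mod m)" | "u = f ((i + 1) mod m)" "v = f i"
    by (auto simp: doubleton_eq_iff)
  then show ?thesis
  proof cases
    case 1
    then show ?thesis using rot[OF inj _ i(1)] by auto
  next
    case 2
    \<comment> \<open>\<open>?j\<close> is the position that \<open>f ((i + 1) mod m)\<close> takes
      in the reversed labelling \<open>?h\<close>; its successor there is
      \<open>f i\<close>.\<close>
    let ?h = "\<lambda>j. f (m - 1 - j)" and ?j = "m - 1 - (i + 1) mod m"
    have j: "?j < m" "m - 1 - ?j = (i + 1) mod m" "m - 1 - (?j + 1) mod m = i"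
      using i m by (auto simp: mod_Suc)
    show ?thesis
      using rot[OF cycle_edges_reverse(2)[OF inj] cycle_edges_reverse(1) j(1)]
      unfolding 2 j(2,3) .
  qed
qed

text \<open>A labelling of \<open>C\<close> corresponds to the arc formed by its first two vertices,
  and the \<open>m\<close> edges of \<open>C\<close> give \<open>2 * m\<close> arcs.\<close>

lemma card_cycle_embeddings_of_cycle:
  assumes "m \<ge> 3" "C \<in> cycle_subgraphs m E" "simple_graph n E"
  shows "card {f \<in> cycle_embeddings m E. cycle_edges m f = C} = 2 * m"
proof -
  obtain f where f: "inj_on f {..<m}" "C = cycle_edges m f" "C \<subseteq> E"
    using assms by (auto simp: cycle_subgraphs_def)
  let ?F = "{f \<in> cycle_embeddings m E. cycle_edges m f = C}"
  \<comment> \<open>A labelled cycle inside \<open>C\<close> has as many edges as \<open>C\<close>,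
    hence uses all of them.\<close>
  have F: "?F = cycle_embeddings m C"
    using f cycle_embedding_edges_eq[OF assms(1) f(1)] by (auto simp: cycle_embeddings_def)
  have "bij_betw (\<lambda>f. (f 0, f 1)) (cycle_embeddings m C) (arcs C)"
  proof (rule bij_betw_imageI)
    show "inj_on (\<lambda>f. (f 0, f 1)) (cycle_embeddings m C)"
    proof (rule inj_onI)
      fix g h assume g: "g \<in> cycle_embeddings m C" and h: "h \<in> cycle_embeddings m C"
        and eq: "(g 0, g 1) = (h 0, h 1)"
      have "C = cycle_edges m h"
        using h F by auto
      then show "g = h"
        using cycle_embedding_eqI[OF assms(1) g h] eq by auto
    qed
    show "(\<lambda>f. (f 0, f 1)) ` cycle_embeddings m C = arcs C"
    proof (intro equalityI subsetI)
      fix p assume "p \<in> (\<lambda>f. (f 0, f 1)) ` cycle_embeddings m C"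
      then show "p \<in> arcs C"
        using assms(1) by (force simp: cycle_embeddings_def arcs_def cycle_edges_subset_iff)
    next
      fix p assume "p \<in> arcs C"
      then show "p \<in> (\<lambda>f. (f 0, f 1)) ` cycle_embeddings m C"
        using cycle_embedding_through_arc[OF assms(1) f(1)] f(2)
        by (auto simp: arcs_def image_iff)
    qed
  qed
  then have "card ?F = card (arcs C)"
    using F by (simp add: bij_betw_same_card)
  also have "\<dots> = 2 * m"
    using card_arcs[OF simple_graph_subset[OF assms(3) f(3)]] card_cycle_edges[OF assms(1) f(1)] f(2)
    by simp
  finally show ?thesis .
qed

section \<open>From labelled cycles to cycle subgraphs\<close>

lemma cycle_embeddings_subset_PiE:
  assumes "simple_graph n E"
  shows "cycle_embeddings m E \<subseteq> {..<m} \<rightarrow>\<^sub>E {..<n}"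
  using simple_graph_edgeD(1)[OF assms]
  by (auto simp: cycle_embeddings_def cycle_edges_subset_iff PiE_def)

lemma finite_cycle_embeddings: "simple_graph n E \<Longrightarrow> finite (cycle_embeddings m E)"
  by (rule finite_subset[OF cycle_embeddings_subset_PiE]) (auto intro: finite_PiE)

lemma finite_cycle_subgraphs: "simple_graph n E \<Longrightarrow> finite (cycle_subgraphs m E)"
  by (rule finite_subset[of _ "Pow E"]) (auto simp: cycle_subgraphs_def simple_graph_finite)

lemma card_cycle_embeddings:
  assumes "m \<ge> 3" "simple_graph n E"
  shows "card (cycle_embeddings m E) = 2 * m * num_cycles m E"
proof -
  let ?F = "\<lambda>C. {f \<in> cycle_embeddings m E. cycle_edges m f = C}"
  have "cycle_embeddings m E = (\<Union>C\<in>cycle_subgraphs m E. ?F C)"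
    by (auto simp: cycle_embeddings_def cycle_subgraphs_def)
  also have "card \<dots> = (\<Sum>C\<in>cycle_subgraphs m E. card (?F C))"
    by (rule card_UN_disjoint)
      (use finite_cycle_embeddings[OF assms(2)] finite_cycle_subgraphs[OF assms(2)] in auto)
  also have "\<dots> = 2 * m * num_cycles m E"
    using card_cycle_embeddings_of_cycle[OF assms(1) _ assms(2)] by (simp add: num_cycles_def)
  finally show ?thesis .
qed

subsection \<open>Even cycles, edges and triangles\<close>

text \<open>Ordered triples: in a simple graph each triangle occurs six times.\<close>

definition triangles :: "nat set set \<Rightarrow> (nat \<times> nat \<times> nat) set" where
  "triangles E = {(a, b, c). {a, b} \<in> E \<and> {b, c} \<in> E \<and> {a, c} \<in> E}"

lemma triangles_subset:
  assumes "simple_graph n E"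
  shows "triangles E \<subseteq> {..<n} \<times> {..<n} \<times> {..<n}"
  using simple_graph_edgeD[OF assms] by (auto simp: triangles_def)

lemma finite_triangles: "simple_graph n E \<Longrightarrow> finite (triangles E)"
  by (rule finite_subset[OF triangles_subset]) auto

text \<open>The labelling is rebuilt from left to right out of its edges at positions
  \<open>2 * i\<close>, \<open>2 * i + 1\<close>. The vertex \<open>f 0\<close> orients the first
  edge, whence the factor 2; afterwards reversing an edge would create a triangle with the vertex
  before it.\<close>

lemma card_triangle_free_embeddings_le:
  assumes E: "simple_graph n E" and l: "l \<ge> 1"
  shows "card {f \<in> cycle_embeddings (2 * l) E. \<forall>j. j + 2 < 2 * l \<longrightarrow> (f j, f (j + 1), f (j + 2)) \<notin> triangles E}
      \<le> 2 * card E ^ l"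
    (is "card ?G \<le> _")
proof -
  let ?s = "\<lambda>f. restrict (\<lambda>i. {f (2 * i), f (2 * i + 1)}) {..<l}"
  \<comment> \<open>The second component is one of the two endpoints of the first edge of the
    sequence.\<close>
  let ?T = "SIGMA s:{..<l} \<rightarrow>\<^sub>E E. s 0"
  have finE: "finite E"
    using E by (rule simple_graph_finite)
  have fin: "finite ({..<l} \<rightarrow>\<^sub>E E)"
    using finE by (intro finite_PiE) auto
  have s0: "card (s 0) = 2" if "s \<in> {..<l} \<rightarrow>\<^sub>E E" for s
    using that l simple_graph_card_edge[OF E] by (auto simp: PiE_iff)
  have s0': "finite (s 0)" if "s \<in> {..<l} \<rightarrow>\<^sub>E E" for s
    using s0[OF that] card.infinite by fastforce
  have edge: "{f j, f (j + 1)} \<in> E" if "f \<in> ?G" "j + 1 < 2 * l" for f j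
  proof -
    have "\<forall>i<2 * l. {f i, f ((i + 1) mod (2 * l))} \<in> E"
      using that by (simp add: cycle_embeddings_def cycle_edges_subset_iff)
    then have "{f j, f ((j + 1) mod (2 * l))} \<in> E"
      by (rule allE[of _ j]) (use that(2) in simp)
    then show ?thesis using that(2) by simp
  qed
  have "inj_on (\<lambda>f. (?s f, f 0)) ?G"
  proof (rule inj_onI)
    fix f g assume f: "f \<in> ?G" and g: "g \<in> ?G" and "(?s f, f 0) = (?s g, g 0)"
    then have s: "?s f = ?s g" and eq0: "f 0 = g 0"
      by auto
    have pair: "{f (2 * i), f (2 * i + 1)} = {g (2 * i), g (2 * i + 1)}" if "i < l" for i
      using fun_cong[OF s, of i] that by simp
    have step: "i < l \<longrightarrow> f (2 * i) = g (2 * i) \<and> f (2 * i + 1) = g (2 * i + 1)" for i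
    proof (induction i)
      case 0
      then show ?case
        using pair[of 0] eq0 l by (auto simp: doubleton_eq_iff)
    next
      case (Suc i)
      show ?case
      proof
        assume i: "Suc i < l"
        let ?j = "2 * i + 1"
        have IH: "f ?j = g ?j"
          using Suc i by auto
        have "\<not> (f (?j + 1) = g (?j + 2) \<and> f (?j + 2) = g (?j + 1))"
        proof
          assume swap: "f (?j + 1) = g (?j + 2) \<and> f (?j + 2) = g (?j + 1)"
          \<comment> \<open>After the swap, the edge of \<open>g\<close> between its positions
            \<open>?j\<close> and \<open>?j + 1\<close> is the chord of \<open>f\<close> that closes
            the triangle.\<close>
          have "{f ?j, f (?j + 2)} \<in> E"
            using edge[OF g, of ?j] swap IH i by simp
          moreover have "{f ?j, f (?j + 1)} \<in> E" "{f (?j + 1), f (?j + 2)} \<in> E"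
            using edge[OF f, of ?j] edge[OF f, of "?j + 1"] i by auto
          ultimately have "(f ?j, f (?j + 1), f (?j + 2)) \<in> triangles E"
            by (simp add: triangles_def)
          moreover have "?j + 2 < 2 * l"
            using i by simp
          ultimately show False
            using f by blast
        qed
        then show "f (2 * Suc i) = g (2 * Suc i) \<and> f (2 * Suc i + 1) = g (2 * Suc i + 1)"
          using pair[OF i] by (auto simp: doubleton_eq_iff)
      qed
    qed
    have "f j = g j" if "j < 2 * l" for j
    proof (cases "even j")
      case True
      then show ?thesis using step[of "j div 2"] that by auto
    next
      case False
      then show ?thesis using step[of "j div 2"] that by auto
    qed
    moreover have "f \<in> extensional {..<2 * l}" "g \<in> extensional {..<2 * l}"
      using f g by (auto simp: cycle_embeddings_def)
    ultimately show "f = g"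
      by (intro extensionalityI[of _ "{..<2 * l}"]) auto
  qed
  moreover have "(\<lambda>f. (?s f, f 0)) ` ?G \<subseteq> ?T"
  proof
    fix p assume "p \<in> (\<lambda>f. (?s f, f 0)) ` ?G"
    then obtain f where p: "p = (?s f, f 0)" and f: "f \<in> ?G"
      by auto
    have "?s f i \<in> E" if "i < l" for i
      using edge[OF f, of "2 * i"] that by simp
    then have "?s f \<in> {..<l} \<rightarrow>\<^sub>E E"
      by (simp add: PiE_iff del: restrict_apply)
    moreover have "f 0 \<in> ?s f 0"
      using l by simp
    ultimately show "p \<in> ?T"
      using p by blast
  qed
  moreover have "finite ?T"
    using fin s0' by (intro finite_SigmaI) auto
  ultimately have "card ?G \<le> card ?T"
    by (rule card_inj_on_le)
  also have "card ?T = (\<Sum>s\<in>{..<l} \<rightarrow>\<^sub>E E. card (s 0))"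
    using fin s0' by (intro card_SigmaI) auto
  also have "\<dots> = 2 * card E ^ l"
    using s0 by (simp add: card_funcsetE)
  finally show ?thesis .
qed

text \<open>Once the triangle at positions \<open>j\<close>, \<open>j + 1\<close>,
  \<open>j + 2\<close> is chosen, each of the other \<open>m - 3\<close> positions has at most
  \<open>n\<close> values.\<close>

lemma card_triangle_at_le:
  assumes E: "simple_graph n E" and j: "j + 2 < m"
  shows "card {f \<in> cycle_embeddings m E. (f j, f (j + 1), f (j + 2)) \<in> triangles E}
      \<le> card (triangles E) * n ^ (m - 3)"
    (is "card ?B \<le> _")
proof -
  let ?J = "{..<m} - {j, j + 1, j + 2}"
  have cardJ: "card ?J = m - 3"
    using j by (subst card_Diff_subset) auto
  have "inj_on (\<lambda>f. ((f j, f (j + 1), f (j + 2)), restrict f ?J)) ?B"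
  proof (rule inj_onI)
    fix f g assume f: "f \<in> ?B" and g: "g \<in> ?B"
      and eq: "((f j, f (j + 1), f (j + 2)), restrict f ?J) = ((g j, g (j + 1), g (j + 2)), restrict g ?J)"
    then have req: "restrict f ?J = restrict g ?J"
      by blast
    have "f i = g i" if "i < m" for i
    proof (cases "i \<in> ?J")
      case True
      then show ?thesis
        using fun_cong[OF req, of i] by (simp only: restrict_apply if_True)
    next
      case False
      then show ?thesis
        using eq that by auto
    qed
    moreover have "f \<in> extensional {..<m}" "g \<in> extensional {..<m}"
      using f g by (auto simp: cycle_embeddings_def)
    ultimately show "f = g"
      by (intro extensionalityI[of _ "{..<m}"]) auto
  qed
  moreover have "(\<lambda>f. ((f j, f (j + 1), f (j + 2)), restrict f ?J)) ` ?B
      \<subseteq> triangles E \<times> (?J \<rightarrow>\<^sub>E {..<n})"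
  proof (intro image_subsetI SigmaI restrict_PiE_iff[THEN iffD2] ballI)
    fix f i assume "f \<in> ?B" "i \<in> ?J"
    then show "f i \<in> {..<n}"
      using cycle_embeddings_subset_PiE[OF E, of m] by blast
  qed blast
  moreover have "finite (triangles E \<times> (?J \<rightarrow>\<^sub>E {..<n}))"
    using finite_triangles[OF E] by (auto intro!: finite_PiE)
  ultimately have "card ?B \<le> card (triangles E \<times> (?J \<rightarrow>\<^sub>E {..<n}))"
    by (rule card_inj_on_le)
  also have "\<dots> = card (triangles E) * n ^ (m - 3)"
    by (simp only: card_cartesian_product card_funcsetE finite_Diff finite_lessThan cardJ card_lessThan)
  finally show ?thesis .
qed

lemma card_even_cycle_embeddings_le:
  assumes E: "simple_graph n E" and l: "l \<ge> 1"
  shows "card (cycle_embeddings (2 * l) E)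
      \<le> 2 * card E ^ l + 2 * l * (card (triangles E) * n ^ (2 * l - 3))"
proof -
  let ?G = "{f \<in> cycle_embeddings (2 * l) E. \<forall>j. j + 2 < 2 * l \<longrightarrow> (f j, f (j + 1), f (j + 2)) \<notin> triangles E}"
  let ?B = "\<lambda>j. {f \<in> cycle_embeddings (2 * l) E. (f j, f (j + 1), f (j + 2)) \<in> triangles E}"
  let ?J = "{j. j + 2 < 2 * l}"
  have J: "?J = {..<2 * l - 2}"
    by auto
  have "card (cycle_embeddings (2 * l) E) = card (?G \<union> (\<Union>j\<in>?J. ?B j))"
    by (rule arg_cong[where f = card]) auto
  also have "\<dots> \<le> card ?G + card (\<Union>j\<in>?J. ?B j)"
    by (rule card_Un_le)
  also have "card (\<Union>j\<in>?J. ?B j) \<le> (\<Sum>j\<in>?J. card (?B j))"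
    by (rule card_UN_le) (simp only: J finite_lessThan)
  also have "(\<Sum>j\<in>?J. card (?B j)) \<le> card ?J * (card (triangles E) * n ^ (2 * l - 3))"
    using sum_bounded_above[of ?J "\<lambda>j. card (?B j)" "card (triangles E) * n ^ (2 * l - 3)"]
      card_triangle_at_le[OF E, of _ "2 * l"] by simp
  \<comment> \<open>There are \<open>2 * l - 2\<close> possible starting positions, rounded up to
    \<open>2 * l\<close>.\<close>
  also have "\<dots> \<le> 2 * l * (card (triangles E) * n ^ (2 * l - 3))"
    unfolding J by (rule mult_right_mono) simp_all
  finally show ?thesis
    using card_triangle_free_embeddings_le[OF E l] by linarith
qed

subsection \<open>Graphs without a given odd cycle\<close>

definition arcs_on :: "nat set set \<Rightarrow> nat set \<Rightarrow> (nat \<times> nat) set" where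
  "arcs_on E S = arcs E \<inter> S \<times> S"

definition nbh :: "nat set set \<Rightarrow> nat \<Rightarrow> nat set" where
  "nbh E v = {u. {v, u} \<in> E}"

lemma nbh_subset:
  assumes "simple_graph n E"
  shows "nbh E v \<subseteq> {..<n}"
  using simple_graph_edgeD[OF assms] by (auto simp: nbh_def)

lemma finite_nbh: "simple_graph n E \<Longrightarrow> finite (nbh E v)"
  using finite_subset[OF nbh_subset] by blast

lemma card_nbh_le: "simple_graph n E \<Longrightarrow> card (nbh E v) \<le> n"
  using card_mono[OF _ nbh_subset, of n E v] by simp

section \<open>Paths inside a vertex set, and triangles\<close>

definition path_list :: "nat set set \<Rightarrow> nat list \<Rightarrow> bool" where
  "path_list E xs \<longleftrightarrow> distinct xs \<and> successively (\<lambda>a b. {a, b} \<in> E) xs"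

text \<open>Greedy growth at the head: a path with at most \<open>p\<close> vertices cannot contain
  all the neighbours of its first vertex.\<close>

lemma path_of_min_degree:
  assumes E: "simple_graph n E" and S: "S \<noteq> {}"
    and deg: "\<And>a. a \<in> S \<Longrightarrow> p \<le> card (nbh E a \<inter> S)"
  shows "q \<le> p \<Longrightarrow> \<exists>xs. path_list E xs \<and> set xs \<subseteq> S \<and> length xs = q + 1"
proof (induction q)
  case 0
  obtain a where "a \<in> S" using S by auto
  then show ?case
    by (intro exI[of _ "[a]"]) (simp add: path_list_def)
next
  case (Suc q)
  then obtain xs where xs: "path_list E xs" "set xs \<subseteq> S" "length xs = q + 1"
    by auto
  then obtain a ys where a: "xs = a # ys"
    by (cases xs) auto
  \<comment> \<open>The tail \<open>ys\<close> has only \<open>q < p\<close> entries. The head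
    \<open>a\<close> is not its own neighbour, so avoiding \<open>ys\<close> is enough.\<close>
  have "\<not> nbh E a \<inter> S \<subseteq> set ys"
  proof
    assume "nbh E a \<inter> S \<subseteq> set ys"
    then have "card (nbh E a \<inter> S) \<le> length ys"
      using card_mono[of "set ys" "nbh E a \<inter> S"] card_length[of ys] by simp
    then show False
      using deg[of a] Suc.prems xs a by auto
  qed
  then obtain b where b: "{a, b} \<in> E" "b \<in> S" "b \<notin> set ys"
    by (auto simp: nbh_def)
  have "b \<noteq> a"
    using simple_graph_edgeD(3)[OF E b(1)] by simp
  then have "path_list E (b # xs)"
    using b xs by (auto simp: path_list_def a insert_commute)
  then show ?case
    using b xs by (intro exI[of _ "b # xs"]) auto
qed

text \<open>Deleting a vertex with fewer than \<open>p\<close> neighbours in \<open>S\<close> costs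
  at most \<open>2 * p\<close> arcs, so the density hypothesis survives. The deletions end at a set
  of minimum degree at least \<open>p\<close>, which is nonempty because it still carries
  arcs.\<close>

lemma path_of_many_arcs:
  assumes E: "simple_graph n E" and S: "finite S"
    and "2 * p * card S < card (arcs_on E S)"
  shows "\<exists>xs. path_list E xs \<and> set xs \<subseteq> S \<and> length xs = p + 1"
  using S assms(3)
proof (induction S rule: finite_psubset_induct)
  case (psubset S)
  show ?case
  proof (cases "\<forall>a\<in>S. p \<le> card (nbh E a \<inter> S)")
    case True
    have "S \<noteq> {}"
      using psubset.prems by (auto simp: arcs_on_def)
    then show ?thesis
      using path_of_min_degree[OF E, of S p p] True by auto
  next
    case False
    then obtain a where a: "a \<in> S" "card (nbh E a \<inter> S) < p"
      by auto
    let ?N = "nbh E a \<inter> S"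
    have fin: "finite (arcs_on E (S - {a}))" "finite ?N"
      using finite_arcs[OF E] finite_nbh[OF E] by (auto simp: arcs_on_def)
    have "arcs_on E S \<subseteq> arcs_on E (S - {a}) \<union> (Pair a ` ?N \<union> (\<lambda>b. (b, a)) ` ?N)"
      by (auto simp: arcs_on_def arcs_def nbh_def insert_commute)
    then have "card (arcs_on E S) \<le> card (arcs_on E (S - {a}) \<union> (Pair a ` ?N \<union> (\<lambda>b. (b, a)) ` ?N))"
      using fin by (intro card_mono) auto
    also have "\<dots> \<le> card (arcs_on E (S - {a})) + (card (Pair a ` ?N) + card ((\<lambda>b. (b, a)) ` ?N))"
      by (meson add_left_mono card_Un_le le_trans)
    also have "\<dots> \<le> card (arcs_on E (S - {a})) + 2 * p"
      using card_image_le[OF fin(2), of "Pair a"] card_image_le[OF fin(2), of "\<lambda>b. (b, a)"] a(2)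
      by linarith
    finally have le: "card (arcs_on E S) \<le> card (arcs_on E (S - {a})) + 2 * p" .
    have "card S = card (S - {a}) + 1"
      using psubset.hyps a(1) by (metis Suc_eq_plus1 card_Suc_Diff1)
    then have "2 * p * card (S - {a}) < card (arcs_on E (S - {a}))"
      using le psubset.prems by simp
    then show ?thesis
      using psubset.IH[of "S - {a}"] a(1) by blast
  qed
qed

text \<open>Joining both ends of the path to \<open>v\<close> closes a cycle with one more
  vertex.\<close>

lemma has_cycle_of_path_in_nbh:
  assumes E: "simple_graph n E" and xs: "path_list E xs" "set xs \<subseteq> nbh E v" "xs \<noteq> []"
  shows "has_cycle (length xs + 1) E"
proof -
  let ?m = "length xs + 1" and ?f = "\<lambda>i. (v # xs) ! i"
  have v: "v \<notin> set xs"
    using xs(2) simple_graph_edgeD(3)[OF E, of v v] by (auto simp: nbh_def)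
  then have "distinct (v # xs)"
    using xs by (simp add: path_list_def)
  then have "inj_on ?f {..<?m}"
    by (intro inj_onI) (auto simp: nth_eq_iff_index_eq simp del: distinct.simps)
  moreover have "cycle_edges ?m ?f \<subseteq> E"
    unfolding cycle_edges_subset_iff
  proof (intro allI impI)
    fix i assume i: "i < ?m"
    have spoke: "{v, xs ! j} \<in> E" if "j < length xs" for j
      using xs(2) nth_mem[OF that] by (auto simp: nbh_def)
    \<comment> \<open>The cycle leaves \<open>v\<close> by a spoke, returns to it by a spoke from
      the last entry, and otherwise follows the path.\<close>
    consider "i = 0" | "i = length xs" "i > 0" | j where "i = Suc j" "Suc j < length xs"
      using i by (cases "i = 0"; cases "i = length xs") (auto dest: gr0_implies_Suc)
    then show "{?f i, ?f ((i + 1) mod ?m)} \<in> E"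
    proof cases
      case 1
      then show ?thesis using spoke[of 0] xs(3) by (auto simp: mod_Suc)
    next
      case 2
      then show ?thesis using spoke[of "length xs - 1"] by (auto simp: nth_Cons' insert_commute)
    next
      case (3 j)
      then show ?thesis
        using xs(1) by (auto simp: path_list_def successively_conv_nth)
    qed
  qed
  ultimately show ?thesis
    by (auto simp: has_cycle_def cycle_subgraphs_def)
qed

text \<open>Triangles with first vertex \<open>v\<close> are arcs inside its neighbourhood. Too many
  of them would yield a path on \<open>2 * k\<close> vertices there, and with \<open>v\<close> the
  forbidden cycle.\<close>

lemma card_triangles_le:
  assumes E: "simple_graph n E" and k: "k \<ge> 1" and free: "\<not> has_cycle (2 * k + 1) E"
  shows "card (triangles E) \<le> 4 * k * n ^ 2"
proof -
  have nb: "card (arcs_on E (nbh E v)) \<le> 4 * k * n" for v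
  proof -
    \<comment> \<open>\<open>path_of_many_arcs\<close> is used with \<open>p = 2 * k - 1\<close>, so
      that the path has \<open>2 * k\<close> vertices.\<close>
    have "\<not> 2 * (2 * k - 1) * card (nbh E v) < card (arcs_on E (nbh E v))"
    proof
      assume "2 * (2 * k - 1) * card (nbh E v) < card (arcs_on E (nbh E v))"
      from path_of_many_arcs[OF E finite_nbh[OF E] this] obtain xs
        where "path_list E xs" "set xs \<subseteq> nbh E v" "length xs = 2 * k"
        using k by auto
      moreover from this have "xs \<noteq> []"
        using k by auto
      ultimately show False
        using has_cycle_of_path_in_nbh[OF E, of xs v] free by simp
    qed
    then have "card (arcs_on E (nbh E v)) \<le> 2 * (2 * k - 1) * card (nbh E v)"
      by simp
    also have "\<dots> \<le> 4 * k * n"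
      using card_nbh_le[OF E] by (intro mult_mono[of "2 * (2 * k - 1)"]) auto
    finally show ?thesis .
  qed
  have "triangles E \<subseteq> (SIGMA v:{..<n}. arcs_on E (nbh E v))"
    using simple_graph_edgeD[OF E] by (auto simp: triangles_def arcs_on_def arcs_def nbh_def)
  moreover have fin: "finite (arcs_on E (nbh E v))" for v
    using finite_arcs[OF E] by (auto simp: arcs_on_def)
  ultimately have "card (triangles E) \<le> card (SIGMA v:{..<n}. arcs_on E (nbh E v))"
    by (intro card_mono finite_SigmaI) auto
  also have "\<dots> = (\<Sum>v<n. card (arcs_on E (nbh E v)))"
    using fin by (intro card_SigmaI) auto
  also have "\<dots> \<le> n * (4 * k * n)"
    using sum_bounded_above[of "{..<n}" "\<lambda>v. card (arcs_on E (nbh E v))" "4 * k * n"] nb by simp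
  finally show ?thesis
    by (simp add: power2_eq_square algebra_simps)
qed

section \<open>Degree sums, the edge bound and the upper bound for cycles\<close>

lemma arcs_eq_Sigma:
  assumes "simple_graph n E"
  shows "arcs E = (SIGMA v:{..<n}. nbh E v)"
  using simple_graph_edgeD[OF assms] by (auto simp: arcs_def nbh_def)

lemma card_arcs_eq_sum:
  assumes "simple_graph n E"
  shows "card (arcs E) = (\<Sum>v<n. card (nbh E v))"
  unfolding arcs_eq_Sigma[OF assms] using finite_nbh[OF assms] by (intro card_SigmaI) auto

text \<open>Mantel's degree-sum argument with the triangles kept: adjacent vertices whose degrees
  sum to more than \<open>n\<close> have common neighbours. Summing over arcs bounds the sum of
  squared degrees, and Cauchy-Schwarz brings back the number of arcs.\<close>

lemma arcs_triangles_ineq: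
  assumes E: "simple_graph n E"
  shows "2 * card (arcs E) ^ 2 \<le> n ^ 2 * card (arcs E) + n * card (triangles E)"
proof -
  let ?d = "\<lambda>v. card (nbh E v)"
  have fin: "finite (nbh E v)" for v
    using E by (rule finite_nbh)
  \<comment> \<open>Each vertex \<open>u\<close> is the first entry of exactly \<open>?d u\<close>
    arcs.\<close>
  have sum_fst: "(\<Sum>(u, v)\<in>arcs E. ?d u) = (\<Sum>u<n. ?d u ^ 2)"
    unfolding arcs_eq_Sigma[OF E] using fin
    by (subst sum.Sigma[symmetric]) (auto simp: power2_eq_square)
  have sum_snd: "(\<Sum>(u, v)\<in>arcs E. ?d v) = (\<Sum>(u, v)\<in>arcs E. ?d u)"
    by (rule sum.reindex_bij_witness[of _ prod.swap prod.swap]) (auto simp: arcs_def insert_commute)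
  \<comment> \<open>A triangle is an arc together with a common neighbour of its two ends.\<close>
  have tri: "triangles E = (\<lambda>((u, v), w). (u, v, w)) ` (SIGMA p:arcs E. nbh E (fst p) \<inter> nbh E (snd p))"
    by (force simp: triangles_def arcs_def nbh_def image_iff)
  have "card (triangles E) = card (SIGMA p:arcs E. nbh E (fst p) \<inter> nbh E (snd p))"
    unfolding tri by (rule card_image) (auto simp: inj_on_def)
  also have "\<dots> = (\<Sum>(u, v)\<in>arcs E. card (nbh E u \<inter> nbh E v))"
    using fin finite_arcs[OF E] by (subst card_SigmaI) (auto simp: case_prod_beta)
  finally have card_tri: "card (triangles E) = (\<Sum>(u, v)\<in>arcs E. card (nbh E u \<inter> nbh E v))" .
  have "?d u + ?d v \<le> n + card (nbh E u \<inter> nbh E v)" for u v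
    using card_Un_Int[OF fin fin, of u v] card_mono[of "{..<n}" "nbh E u \<union> nbh E v"] nbh_subset[OF E]
    by simp
  then have "(\<Sum>(u, v)\<in>arcs E. ?d u + ?d v) \<le> (\<Sum>(u, v)\<in>arcs E. n + card (nbh E u \<inter> nbh E v))"
    by (intro sum_mono) auto
  then have "(\<Sum>(u, v)\<in>arcs E. ?d u) + (\<Sum>(u, v)\<in>arcs E. ?d v) \<le> n * card (arcs E) + card (triangles E)"
    unfolding card_tri by (simp add: case_prod_beta sum.distrib mult.commute)
  then have deg: "2 * (\<Sum>u<n. ?d u ^ 2) \<le> n * card (arcs E) + card (triangles E)"
    unfolding sum_snd sum_fst by simp
  have "(\<Sum>u<n. real (?d u) * 1) ^ 2 \<le> (\<Sum>u<n. real (?d u) ^ 2) * (\<Sum>u<n. 1 ^ 2)"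
    by (rule Cauchy_Schwarz_ineq_sum)
  then have "real (card (arcs E) ^ 2) \<le> real (n * (\<Sum>u<n. ?d u ^ 2))"
    by (simp add: card_arcs_eq_sum[OF E] mult.commute)
  then have "card (arcs E) ^ 2 \<le> n * (\<Sum>u<n. ?d u ^ 2)"
    by linarith
  then have "2 * card (arcs E) ^ 2 \<le> n * (2 * (\<Sum>u<n. ?d u ^ 2))"
    by simp
  also have "\<dots> \<le> n * (n * card (arcs E) + card (triangles E))"
    using deg by (rule mult_left_mono) simp
  finally show ?thesis
    by (simp add: power2_eq_square algebra_simps)
qed

text \<open>Write \<open>M\<close> for the number of arcs, twice the number of edges. The two
  triangle bounds give \<open>M * (2 * M - n^2) \<le> 4 * k * n^3\<close>. An excess would make the
  first factor at least \<open>n^2 / 2\<close> and the second larger than \<open>8 * k * n\<close>,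
  a contradiction.\<close>

lemma card_edges_le:
  assumes E: "simple_graph n E" and k: "k \<ge> 1" and free: "\<not> has_cycle (2 * k + 1) E"
  shows "real (card E) \<le> real n ^ 2 / 4 + 2 * real k * real n"
proof (rule ccontr)
  let ?M = "real (card (arcs E))"
  assume "\<not> ?thesis"
  then have M: "?M > real n ^ 2 / 2 + 4 * real k * real n"
    by (simp add: card_arcs[OF E])
  have "n * card (triangles E) \<le> n * (4 * k * n ^ 2)"
    using card_triangles_le[OF assms] by (rule mult_left_mono) simp
  then have "2 * card (arcs E) ^ 2 \<le> n ^ 2 * card (arcs E) + n * (4 * k * n ^ 2)"
    using arcs_triangles_ineq[OF E] by linarith
  then have "real (2 * card (arcs E) ^ 2) \<le> real (n ^ 2 * card (arcs E) + n * (4 * k * n ^ 2))"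
    by (simp only: of_nat_le_iff)
  then have *: "?M * (2 * ?M - real n ^ 2) \<le> 4 * real k * real n * real n ^ 2"
    by (simp add: power2_eq_square algebra_simps)
  have "?M > 0"
    using M by (rule le_less_trans[rotated]) simp
  then have "?M * (8 * real k * real n) < ?M * (2 * ?M - real n ^ 2)"
    using M by (intro mult_strict_left_mono) auto
  moreover have "(real n ^ 2 / 2) * (8 * real k * real n) \<le> ?M * (8 * real k * real n)"
  proof (rule mult_right_mono)
    have "0 \<le> 4 * real k * real n" by simp
    then show "real n ^ 2 / 2 \<le> ?M" using M by linarith
  qed simp
  ultimately show False
    using * by (simp add: algebra_simps)
qed

text \<open>Each cycle has \<open>4 * l\<close> labellings. Dividing by this leaves the main term
  from the edge sequences and a term of lower order from labelled cycles containing a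
  triangle.\<close>

lemma num_even_cycles_le:
  assumes E: "simple_graph n E" and k: "k \<ge> 1" and l: "l \<ge> 2" and free: "\<not> has_cycle (2 * k + 1) E"
  shows "real (num_cycles (2 * l) E)
    \<le> 1 / (2 * real l) * (real n ^ 2 / 4 + 2 * real k * real n) ^ l + 2 * real k * real n ^ (2 * l - 1)"
proof -
  have "4 * l * num_cycles (2 * l) E = card (cycle_embeddings (2 * l) E)"
    using card_cycle_embeddings[OF _ E, of "2 * l"] l by simp
  also have "\<dots> \<le> 2 * card E ^ l + 2 * l * (card (triangles E) * n ^ (2 * l - 3))"
    using card_even_cycle_embeddings_le[OF E] l by simp
  also have "\<dots> \<le> 2 * card E ^ l + 2 * l * (4 * k * n ^ 2 * n ^ (2 * l - 3))"
    using card_triangles_le[OF E k free] by (intro add_mono mult_mono) auto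
  also have "4 * k * n ^ 2 * n ^ (2 * l - 3) = 4 * k * n ^ (2 + (2 * l - 3))"
    unfolding power_add by simp
  also have "2 + (2 * l - 3) = 2 * l - 1"
    using l by simp
  finally have "real (4 * l * num_cycles (2 * l) E)
      \<le> real (2 * card E ^ l + 2 * l * (4 * k * n ^ (2 * l - 1)))"
    by (simp only: of_nat_le_iff)
  also have "\<dots> = 2 * real (card E) ^ l + 8 * real l * real k * real n ^ (2 * l - 1)"
    by simp
  also have "\<dots> \<le> 2 * (real n ^ 2 / 4 + 2 * real k * real n) ^ l + 8 * real l * real k * real n ^ (2 * l - 1)"
    using card_edges_le[OF E k free] by (intro add_right_mono mult_left_mono power_mono) auto
  finally show ?thesis
    using l by (simp add: field_simps)
qed

subsection \<open>The bipartite construction\<close>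

text \<open>The complete bipartite graph between the even and the odd numbers below
  \<open>2 * a\<close>. With \<open>a = n div 2\<close> and \<open>n\<close> odd, one vertex stays
  isolated.\<close>

definition parity_graph :: "nat \<Rightarrow> nat set set" where
  "parity_graph a = {{2 * p, 2 * q + 1} | p q. p < a \<and> q < a}"

lemma parity_graph_edge_parity: "{u, v} \<in> parity_graph a \<Longrightarrow> even u \<noteq> even v"
  by (auto simp: parity_graph_def doubleton_eq_iff)

lemma simple_graph_parity_graph: "2 * a \<le> n \<Longrightarrow> simple_graph n (parity_graph a)"
  unfolding simple_graph_def parity_graph_def
  by clarify (rule exI, rule exI, intro conjI, rule refl, presburger+)

lemma parity_graph_no_odd_cycle: "\<not> has_cycle (2 * k + 1) (parity_graph a)"
proof
  assume "has_cycle (2 * k + 1) (parity_graph a)"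
  then obtain f where f: "cycle_edges (2 * k + 1) f \<subseteq> parity_graph a"
    by (auto simp: has_cycle_def cycle_subgraphs_def)
  then have e: "even (f i) \<noteq> even (f ((i + 1) mod (2 * k + 1)))" if "i < 2 * k + 1" for i
    using that by (intro parity_graph_edge_parity) (auto simp: cycle_edges_subset_iff)
  have "i < 2 * k + 1 \<longrightarrow> (even (f i) \<longleftrightarrow> (even i \<longleftrightarrow> even (f 0)))" for i
  proof (induction i)
    case (Suc i)
    then show ?case
      using e[of i] by auto
  qed simp
  \<comment> \<open>Position \<open>2 * k\<close> has the parity of \<open>f 0\<close>, yet the
    closing edge joins these two vertices.\<close>
  from this[of "2 * k"] e[of "2 * k"] show False
    by simp
qed

text \<open>\<open>b\<close> says whether the cycle starts on the even side; \<open>p\<close> and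
  \<open>q\<close> list its vertices on the even and odd sides in the order in which they are
  visited.\<close>

definition parity_embedding :: "nat \<Rightarrow> bool \<times> (nat \<Rightarrow> nat) \<times> (nat \<Rightarrow> nat) \<Rightarrow> nat \<Rightarrow> nat" where
  "parity_embedding l = (\<lambda>(b, p, q). restrict
    (\<lambda>j. if even j = b then 2 * p (j div 2) else 2 * q (j div 2) + 1) {..<2 * l})"

lemma parity_embedding_mem:
  assumes p: "p \<in> {..<l} \<rightarrow>\<^sub>E {..<a}" "inj_on p {..<l}" and q: "q \<in> {..<l} \<rightarrow>\<^sub>E {..<a}" "inj_on q {..<l}"
  shows "parity_embedding l (b, p, q) \<in> cycle_embeddings (2 * l) (parity_graph a)"
proof -
  let ?f = "parity_embedding l (b, p, q)"
  have f: "?f j = (if even j = b then 2 * p (j div 2) else 2 * q (j div 2) + 1)" if "j < 2 * l" for j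
    using that by (simp add: parity_embedding_def)
  have pq: "p i < a" "q i < a" if "i < l" for i
    using p(1) q(1) that by (auto simp: PiE_iff)
  have "inj_on ?f {..<2 * l}"
  proof (rule inj_onI)
    fix i j assume ij: "i \<in> {..<2 * l}" "j \<in> {..<2 * l}" and eq: "?f i = ?f j"
    have par: "even i = even j"
    proof (rule ccontr)
      assume "even i \<noteq> even j"
      then have "even (?f i) \<noteq> even (?f j)"
        using ij by (auto simp: f)
      then show False using eq by simp
    qed
    have "i div 2 \<in> {..<l}" "j div 2 \<in> {..<l}"
      using ij by auto
    moreover have "p (i div 2) = p (j div 2) \<or> q (i div 2) = q (j div 2)"
      using eq ij par by (auto simp: f split: if_splits)
    ultimately have "i div 2 = j div 2"
      using p(2) q(2) by (auto dest: inj_onD)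
    then show "i = j"
      using par by presburger
  qed
  moreover have "cycle_edges (2 * l) ?f \<subseteq> parity_graph a"
    unfolding cycle_edges_subset_iff
  proof (intro allI impI)
    fix j assume j: "j < 2 * l"
    define i where "i = (j + 1) mod (2 * l)"
    \<comment> \<open>Reduction modulo the even number \<open>2 * l\<close> keeps parity, so the
      sides alternate across the wrap-around too.\<close>
    have "even (j + 1) = even i"
      by (simp only: i_def dvd_mod_iff dvd_triv_left)
    then have i: "i < 2 * l" "even i \<noteq> even j"
      using j by (auto simp: i_def)
    have "i div 2 < l" "j div 2 < l"
      using i j by auto
    note * = pq[OF this(1)] pq[OF this(2)]
    show "{?f j, ?f ((j + 1) mod (2 * l))} \<in> parity_graph a"
    proof (cases "even j = b")
      case True
      then have "{?f j, ?f i} = {2 * p (j div 2), 2 * q (i div 2) + 1}"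
        using i j by (auto simp: f)
      then show ?thesis
        unfolding i_def[symmetric] using * by (auto simp: parity_graph_def)
    next
      case False
      then have "{?f j, ?f i} = {2 * p (i div 2), 2 * q (j div 2) + 1}"
        using i j by (auto simp: f)
      then show ?thesis
        unfolding i_def[symmetric] using * by (auto simp: parity_graph_def)
    qed
  qed
  moreover have "?f \<in> extensional {..<2 * l}"
    by (simp add: parity_embedding_def)
  ultimately show ?thesis
    by (simp add: cycle_embeddings_def)
qed

text \<open>The parity of the value at position 0 reveals \<open>b\<close>; then positions
  \<open>2 * i\<close> and \<open>2 * i + 1\<close> reveal \<open>p i\<close> and
  \<open>q i\<close>.\<close>

lemma parity_embedding_inj:
  assumes l: "l \<ge> 1"
    and ext: "p \<in> extensional {..<l}" "q \<in> extensional {..<l}" "p' \<in> extensional {..<l}" "q' \<in> extensional {..<l}"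
    and eq: "parity_embedding l (b, p, q) = parity_embedding l (b', p', q')"
  shows "b = b' \<and> p = p' \<and> q = q'"
proof -
  have f: "parity_embedding l (b, p, q) j = (if even j = b then 2 * p (j div 2) else 2 * q (j div 2) + 1)"
    if "j < 2 * l" for b p q j
    using that by (simp add: parity_embedding_def)
  have "even (parity_embedding l (b, p, q) 0) = even (parity_embedding l (b', p', q') 0)"
    using eq by simp
  then have b: "b = b'"
    using l by (auto simp: f split: if_splits)
  have "p i = p' i \<and> q i = q' i" if "i < l" for i
  proof -
    have "2 * i < 2 * l" "2 * i + 1 < 2 * l"
      using that by auto
    then show ?thesis
      using fun_cong[OF eq, of "2 * i"] fun_cong[OF eq, of "2 * i + 1"] b
      by (cases b) (auto simp: f)
  qed
  then show ?thesis
    using b ext by (auto intro!: extensionalityI[of _ "{..<l}"])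
qed

lemma num_cycles_parity_graph_ge:
  assumes l: "l \<ge> 2"
  shows "real (num_cycles (2 * l) (parity_graph a)) \<ge> 1 / (2 * real l) * (real (a - l) ^ 2) ^ l"
proof -
  let ?I = "{f \<in> {..<l} \<rightarrow>\<^sub>E {..<a}. inj_on f {..<l}}"
  let ?D = "(UNIV :: bool set) \<times> ?I \<times> ?I"
  have sg: "simple_graph (2 * a) (parity_graph a)"
    by (rule simple_graph_parity_graph) simp
  \<comment> \<open>The number of injections is a falling factorial, each of whose \<open>l\<close>
    factors is at least \<open>a - l\<close>.\<close>
  have "(a - l) ^ l = (\<Prod>i\<in>{0..<l}. a - l)"
    by simp
  also have "\<dots> \<le> (\<Prod>i\<in>{0..<l}. a - i)"
    by (rule prod_mono) auto
  also have "\<dots> = card ?I"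
    using card_inj_on_subset_funcset[of "{..<l}" "{..<a}" "{..<l}"] by simp
  finally have I: "(a - l) ^ l \<le> card ?I" .
  have "inj_on (parity_embedding l) ?D"
    using l by (intro inj_onI) (auto simp: PiE_def dest!: parity_embedding_inj[rotated -1])
  moreover have "parity_embedding l ` ?D \<subseteq> cycle_embeddings (2 * l) (parity_graph a)"
    using parity_embedding_mem by auto
  ultimately have "card ?D \<le> card (cycle_embeddings (2 * l) (parity_graph a))"
    using finite_cycle_embeddings[OF sg] by (rule card_inj_on_le)
  also have "\<dots> = 4 * l * num_cycles (2 * l) (parity_graph a)"
    using card_cycle_embeddings[OF _ sg, of "2 * l"] l by simp
  also have "card ?D = 2 * card ?I ^ 2"
    by (simp add: card_cartesian_product power2_eq_square)
  finally have "2 * card ?I ^ 2 \<le> 4 * l * num_cycles (2 * l) (parity_graph a)" .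
  moreover have "((a - l) ^ l) ^ 2 \<le> card ?I ^ 2"
    using I by (rule power_mono) simp
  ultimately have "((a - l) ^ l) ^ 2 \<le> 2 * l * num_cycles (2 * l) (parity_graph a)"
    by linarith
  then have "real (((a - l) ^ l) ^ 2) \<le> real (2 * l * num_cycles (2 * l) (parity_graph a))"
    by (simp only: of_nat_le_iff)
  then have "(real (a - l) ^ 2) ^ l \<le> 2 * real l * real (num_cycles (2 * l) (parity_graph a))"
    by (simp flip: power_mult add: mult.commute)
  then show ?thesis
    using l by (simp add: field_simps)
qed

section \<open>The extremal number and its asymptotics\<close>

lemma finite_num_cycles_values: "finite {num_cycles h E | E. simple_graph n E \<and> \<not> has_cycle f E}"
proof -
  have "{E. simple_graph n E} \<subseteq> Pow (Pow {..<n})"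
    by (fastforce simp: simple_graph_def)
  then have "finite {E. simple_graph n E}"
    by (rule finite_subset) simp
  then have "finite (num_cycles h ` {E. simple_graph n E})"
    by simp
  then show ?thesis
    by (rule rev_finite_subset) auto
qed

lemma num_cycles_le_ex_cycle:
  assumes "simple_graph n E" "\<not> has_cycle f E"
  shows "num_cycles h E \<le> ex_cycle n h f"
  unfolding ex_cycle_def using assms by (intro Max_ge finite_num_cycles_values) auto

text \<open>A \<open>Max\<close> is attained only over a finite nonempty set; the given
  \<open>E\<close> is there to witness nonemptiness.\<close>

lemma ex_cycle_attained:
  assumes "simple_graph n E" "\<not> has_cycle f E"
  obtains F where "simple_graph n F" "\<not> has_cycle f F" "ex_cycle n h f = num_cycles h F"
proof -
  have "ex_cycle n h f \<in> {num_cycles h E | E. simple_graph n E \<and> \<not> has_cycle f E}"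
    unfolding ex_cycle_def using assms by (intro Max_in finite_num_cycles_values) auto
  then show ?thesis
    using that by auto
qed

lemma ex_even_odd_cycle_le:
  assumes "k \<ge> 1" "l \<ge> 2"
  shows "real (ex_cycle n (2 * l) (2 * k + 1))
    \<le> 1 / (2 * real l) * (real n ^ 2 / 4 + 2 * real k * real n) ^ l + 2 * real k * real n ^ (2 * l - 1)"
proof -
  \<comment> \<open>\<open>parity_graph 0\<close> has no edges, so it is an admissible graph for
    every \<open>n\<close>.\<close>
  obtain F where "simple_graph n F" "\<not> has_cycle (2 * k + 1) F"
    "ex_cycle n (2 * l) (2 * k + 1) = num_cycles (2 * l) F"
    using ex_cycle_attained[OF simple_graph_parity_graph[of 0 n] parity_graph_no_odd_cycle] by auto
  then show ?thesis
    using num_even_cycles_le[OF _ assms] by simp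
qed

lemma ex_even_odd_cycle_ge:
  assumes l: "l \<ge> 2" and n: "n \<ge> 2 * l + 2"
  shows "1 / (2 * real l) * ((real n / 2 - real l - 1) ^ 2) ^ l \<le> real (ex_cycle n (2 * l) (2 * k + 1))"
proof -
  \<comment> \<open>The 1 absorbs the rounding in \<open>n div 2\<close>. The bound on
    \<open>n\<close> makes the left side nonnegative, as monotonicity of powers requires.\<close>
  have "real n / 2 - real l - 1 \<le> real (n div 2 - l)"
    using n by (simp add: of_nat_diff)
  then have "1 / (2 * real l) * ((real n / 2 - real l - 1) ^ 2) ^ l
      \<le> 1 / (2 * real l) * (real (n div 2 - l) ^ 2) ^ l"
    using n by (intro mult_left_mono power_mono) auto
  also have "\<dots> \<le> real (num_cycles (2 * l) (parity_graph (n div 2)))"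
    by (rule num_cycles_parity_graph_ge[OF l])
  also have "\<dots> \<le> real (ex_cycle n (2 * l) (2 * k + 1))"
    using num_cycles_le_ex_cycle[OF simple_graph_parity_graph parity_graph_no_odd_cycle, of "n div 2" n] by simp
  finally show ?thesis .
qed

theorem theorem20:
  fixes k l :: nat
  assumes "k \<ge> 1" and "l \<ge> 2"
  shows "(\<lambda>n. real (ex_cycle n (2 * l) (2 * k + 1)))
           \<sim>[at_top] (\<lambda>n. (1 / (2 * real l)) * (real n ^ 2 / 4) ^ l)"
proof (rule asymp_equivI')
  let ?ex = "\<lambda>n. real (ex_cycle n (2 * l) (2 * k + 1))"
  let ?g = "\<lambda>n. (1 / (2 * real l)) * (real n ^ 2 / 4) ^ l"
  \<comment> \<open>\<open>?lo\<close> and \<open>?hi\<close> are the lower and upper bounds for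
    \<open>?ex\<close> divided by \<open>?g\<close>. For instance \<open>n^2 / 4 + 2 * k * n\<close>
    is \<open>n^2 / 4\<close> times \<open>1 + 8 * k / n\<close>.\<close>
  let ?lo = "\<lambda>n. ((1 - (2 * real l + 2) * inverse (real n)) ^ 2) ^ l"
  let ?hi = "\<lambda>n. (1 + 8 * real k * inverse (real n)) ^ l + 4 * real k * real l * 4 ^ l * inverse (real n)"
  have inv: "(\<lambda>n. inverse (real n)) \<longlonglongrightarrow> 0"
    by (rule lim_inverse_n)
  have "?lo \<longlonglongrightarrow> ((1 - (2 * real l + 2) * 0) ^ 2) ^ l"
    by (intro tendsto_intros inv)
  then have lo: "?lo \<longlonglongrightarrow> 1"
    by simp
  have "?hi \<longlonglongrightarrow> (1 + 8 * real k * 0) ^ l + 4 * real k * real l * 4 ^ l * 0"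
    by (intro tendsto_intros inv)
  then have hi: "?hi \<longlonglongrightarrow> 1"
    by simp
  have ev: "eventually (\<lambda>n. n \<ge> 2 * l + 2) sequentially"
    by (rule eventually_ge_at_top)
  have "?lo n \<le> ?ex n / ?g n" if n: "n \<ge> 2 * l + 2" for n
  proof -
    have "?lo n * ?g n = 1 / (2 * real l) * ((1 - (2 * real l + 2) * inverse (real n)) ^ 2 * (real n ^ 2 / 4)) ^ l"
      unfolding power_mult_distrib by (simp only: mult_ac)
    also have "(1 - (2 * real l + 2) * inverse (real n)) ^ 2 * (real n ^ 2 / 4) = (real n / 2 - real l - 1) ^ 2"
      using n by (simp add: field_simps power2_eq_square)
    finally have "?lo n * ?g n \<le> ?ex n"
      using ex_even_odd_cycle_ge[OF assms(2) n, of k] by (simp only:)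
    moreover have "?g n > 0"
      using n assms by simp
    ultimately show ?thesis
      by (simp only: pos_le_divide_eq)
  qed
  then have lo_le: "eventually (\<lambda>n. ?lo n \<le> ?ex n / ?g n) sequentially"
    by (rule eventually_mono[OF ev])
  have "?ex n / ?g n \<le> ?hi n" if n: "n \<ge> 2 * l + 2" for n
  proof -
    \<comment> \<open>The triangle term has one power of \<open>n\<close> less than
      \<open>?g\<close>, which leaves the factor \<open>inverse (real n)\<close> in
      \<open>?hi\<close>.\<close>
    have "real n ^ (2 * l) = real n * real n ^ (2 * l - 1)"
      using assms by (subst power_Suc[symmetric]) simp
    then have "inverse (real n) * (real n ^ 2) ^ l = real n ^ (2 * l - 1)"
      using n by (simp flip: power_mult add: field_simps)
    moreover have "(real n ^ 2) ^ l = 4 ^ l * (real n ^ 2 / 4) ^ l"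
      by (simp add: power_divide)
    ultimately have 1: "4 * real k * real l * 4 ^ l * inverse (real n) * ?g n = 2 * real k * real n ^ (2 * l - 1)"
      using assms by (simp add: mult.assoc mult.left_commute)
    have "(1 + 8 * real k * inverse (real n)) ^ l * ?g n
        = 1 / (2 * real l) * ((1 + 8 * real k * inverse (real n)) * (real n ^ 2 / 4)) ^ l"
      unfolding power_mult_distrib by (simp only: mult_ac)
    also have "(1 + 8 * real k * inverse (real n)) * (real n ^ 2 / 4) = real n ^ 2 / 4 + 2 * real k * real n"
      using n by (simp add: field_simps power2_eq_square)
    finally have "?hi n * ?g n = 1 / (2 * real l) * (real n ^ 2 / 4 + 2 * real k * real n) ^ l
        + 2 * real k * real n ^ (2 * l - 1)"
      unfolding distrib_right 1 by simp
    then have "?ex n \<le> ?hi n * ?g n"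
      using ex_even_odd_cycle_le[OF assms, of n] by (simp only:)
    moreover have "?g n > 0"
      using n assms by simp
    ultimately show ?thesis
      by (simp only: pos_divide_le_eq)
  qed
  then have le_hi: "eventually (\<lambda>n. ?ex n / ?g n \<le> ?hi n) sequentially"
    by (rule eventually_mono[OF ev])
  show "((\<lambda>n. ?ex n / ?g n) \<longlongrightarrow> 1) at_top"
    by (rule tendsto_sandwich[OF lo_le le_hi lo hi])
qed

end
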